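(* Let $\mathcal I=[0,1]$ and let $m\ge3$ be an integer. For $u\in C^1(\mathcal I)$ and $v\in C^0(\mathcal I)$ define $$\mathcal N^0_1(u)=u'(0),\quad \mathcal N^0_2(u)=u'(1),\quad \mathcal N^0_{i+3}(u)=\int_{\mathcal I}\ell_iu'\,dx\ (i=0,\dots,m-3),\quad \mathcal N^0_{m+1}(u)=u(0)+u(1),$$ $$\mathcal N^1_1(v)=v(0),\quad \mathcal N^1_2(v)=v(1),\quad \mathcal N^1_{i+3}(v)=\int_{\mathcal I}\ell_iv\,dx\ (i=0,\dots,m-3).$$ Let $$\varphi^0_1=x-2x^2+x^3,\ \varphi^0_2=-x^2+x^3,\ \varphi^0_3=-\tfrac12+3x^2-2x^3,\ \varphi^0_{m+1}=\tfrac12,\ \varphi^0_i=K_{i-2}\ (i=4,\dots,m),$$ $$\varphi^1_1=1-4x+3x^2,\ \varphi^1_2=-2x+3x^2,\ \varphi^1_3=6x-6x^2,\ \varphi^1_i=L_{i-2}\ (i=4,\dots,m),$$ and define $I_0\colon C^1\Lambda^0(\mathcal I)\to\mathbb P_m\Lambda^0(\mathcal I)$ and $I_1\colon C^0\Lambda^1(\mathcal I)\to\mathbb P_{m-1}\Lambda^1(\mathcal I)$ by $$I_0u=\sum_{i=1}^{m+1}\mathcal N^0_i(u)\,\varphi^0_i,\qquad I_1v=\sum_{j=1}^m\mathcal N^1_j(v)\,\varphi^1_j.$$ Then for every $u\in C^1\Lambda^0(\mathcal I)$ there holds $d^0I_0u=I_1d^0u$.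
   Context: On an interval, $0$-forms are functions and $1$-forms $v\,dx$ are identified with their coefficient $v$, so $C^1\Lambda^0(\mathcal I)=C^1(\mathcal I)$, $C^0\Lambda^1(\mathcal I)=C^0(\mathcal I)$, $\mathbb P_m\Lambda^0(\mathcal I)=\mathbb P_m(\mathcal I)$, $\mathbb P_{m-1}\Lambda^1(\mathcal I)=\mathbb P_{m-1}(\mathcal I)$ (polynomials of degree at most $m$, resp. $m-1$), and $d^0u=u'$. $\ell_i$ is the Legendre polynomial of degree $i$ on $\mathcal I=[0,1]$ (so the $\ell_i$ are mutually $L^2(\mathcal I)$-orthogonal), normalized by $\ell_i(1)=1$; $L_i(x)=\int_0^x\ell_i(t)\,dt$ and $K_i(x)=\int_0^xL_i(t)\,dt$. *)

theory Defs
  imports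
    "HOL-Analysis.Analysis"
    "HOL-Computational_Algebra.Polynomial"
    "HOL-Library.FuncSet"
begin

section \<open>Forms on the unit interval\<close>

text \<open>
  Functions on \<open>[0,1]\<close> are total functions on the reals of which only the values on \<open>[0,1]\<close>
  matter; 1-forms are identified with their coefficient functions.  The exterior derivative is
  the derivative taken within \<open>[0,1]\<close>, hence one-sided at the end points.
\<close>

definition d0 :: "(real \<Rightarrow> real) \<Rightarrow> real \<Rightarrow> real" where
  "d0 u = (\<lambda>x. vector_derivative u (at x within {0..1}))"

definition C1_Lambda0 :: "(real \<Rightarrow> real) set" where
  "C1_Lambda0 = {u. (\<forall>x\<in>{0..1}. u differentiable (at x within {0..1})) \<and> continuous_on {0..1} (d0 u)}"

definition C0_Lambda1 :: "(real \<Rightarrow> real) set" where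
  "C0_Lambda1 = {v. continuous_on {0..1} v}"

text \<open>Used with \<open>k = m\<close> for polynomial 0-forms and with \<open>k = m - 1\<close> for polynomial 1-forms.\<close>

definition polys_upto :: "nat \<Rightarrow> (real \<Rightarrow> real) set" where
  "polys_upto k = {f. \<exists>p :: real poly. degree p \<le> k \<and> (\<forall>x\<in>{0..1}. f x = poly p x)}"


section \<open>Legendre polynomials on the unit interval and their iterated primitives\<close>

text \<open>
  Rodrigues' formula for the interval \<open>[0,1]\<close>:
  the \<open>i\<close>-th derivative of \<open>(x\<^sup>2 - x)\<^sup>i\<close>, divided by \<open>i!\<close>.
\<close>

definition legendre :: "nat \<Rightarrow> real poly" where
  "legendre i = smult (1 / fact i) ((pderiv ^^ i) ([:0, - 1, 1:] ^ i))"

definition legendre_L :: "nat \<Rightarrow> real \<Rightarrow> real" where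
  "legendre_L i x = integral {0..x} (poly (legendre i))"

definition legendre_K :: "nat \<Rightarrow> real \<Rightarrow> real" where
  "legendre_K i x = integral {0..x} (legendre_L i)"

text \<open>
  The polynomials \<^const>\<open>legendre\<close> have degree \<open>i\<close>, take the value 1 at 1 and
  are mutually orthogonal on \<open>[0,1]\<close>.
\<close>

lemma degree_legendre: "degree (legendre i) = i"
  by (simp add: legendre_def degree_higher_pderiv degree_power_eq)

lemma poly_higher_pderiv_root_power:
  fixes q :: "real poly"
  shows "poly ((pderiv ^^ n) ([:- a, 1:] ^ n * q)) a = fact n * poly q a"
proof (induction n arbitrary: q)
  case (Suc n)
  have "pderiv ([:- a, 1:] ^ Suc n * q)
      = [:- a, 1:] ^ n * (smult (of_nat (Suc n)) q + [:- a, 1:] * pderiv q)"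
    by (simp only: pderiv_mult pderiv_power_Suc) (simp add: pderiv_pCons algebra_simps)
  then have "poly ((pderiv ^^ Suc n) ([:- a, 1:] ^ Suc n * q)) a
      = fact n * poly (smult (of_nat (Suc n)) q + [:- a, 1:] * pderiv q) a"
    by (simp only: funpow_Suc_right o_apply Suc.IH)
  then show ?case by (simp add: algebra_simps)
qed simp

lemma legendre_at_1: "poly (legendre i) 1 = 1"
proof -
  have "[:0, - 1, 1:] ^ i = [:- 1, 1:] ^ i * ([:0, 1:] ^ i :: real poly)"
    by (simp flip: power_mult_distrib)
  then show ?thesis
    by (simp add: legendre_def poly_higher_pderiv_root_power)
qed

lemma higher_pderiv_root_power_eq_0:
  fixes q :: "real poly"
  assumes "k < n"
  shows "poly ((pderiv ^^ k) ([:- a, 1:] ^ n * q)) a = 0"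
proof -
  obtain j where n: "n = k + Suc j"
    using assms less_iff_Suc_add by auto
  have "[:- a, 1:] ^ n * q = [:- a, 1:] ^ k * ([:- a, 1:] ^ Suc j * q)"
    by (simp only: n power_add mult.assoc)
  then show ?thesis
    by (simp only: poly_higher_pderiv_root_power) simp
qed

lemma integral_poly_pderiv_by_parts:
  fixes p q :: "real poly"
  assumes "poly q 0 = 0" "poly q 1 = 0"
  shows "integral {0..1} (poly (p * pderiv q)) = - integral {0..1} (poly (pderiv p * q))"
proof -
  have "(poly (pderiv (p * q)) has_integral poly (p * q) 1 - poly (p * q) 0) {0..1}"
    by (intro fundamental_theorem_of_calculus)
      (auto intro!: has_field_derivative_at_within[OF poly_DERIV]
        simp flip: has_real_derivative_iff_has_vector_derivative simp del: poly_mult)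
  moreover have "poly (p * q) 1 - poly (p * q) 0 = 0"
    using assms by simp
  ultimately have "integral {0..1} (\<lambda>x. poly (p * pderiv q) x + poly (pderiv p * q) x) = 0"
    by (intro integral_unique) (simp add: pderiv_mult mult.commute flip: poly_add poly_mult)
  moreover have "poly (p * pderiv q) integrable_on {0..1}" "poly (pderiv p * q) integrable_on {0..1}"
    by (intro integrable_continuous_real continuous_on_poly continuous_on_id)+
  ultimately show ?thesis
    by (simp add: integral_add del: poly_mult)
qed

lemma integral_mult_legendre_eq_0:
  assumes "degree p < i"
  shows "integral {0..1} (\<lambda>x. poly p x * poly (legendre i) x) = 0"
proof -
  define w :: "real poly" where "w = [:0, - 1, 1:] ^ i"
  have w: "w = [:- 1, 1:] ^ i * [:0, 1:] ^ i" "w = [:- 0, 1:] ^ i * [:- 1, 1:] ^ i"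
    by (simp_all add: w_def flip: power_mult_distrib)
  have "integral {0..1} (poly (p * (pderiv ^^ k) w)) = 0" if "degree p < k" "k \<le> i" for k p
    using that
  proof (induction k arbitrary: p)
    case (Suc k)
    have "poly ((pderiv ^^ k) w) 0 = 0"
      unfolding w(2) using Suc.prems by (intro higher_pderiv_root_power_eq_0) simp
    moreover have "poly ((pderiv ^^ k) w) 1 = 0"
      unfolding w(1) using Suc.prems by (intro higher_pderiv_root_power_eq_0) simp
    ultimately have "integral {0..1} (poly (p * (pderiv ^^ Suc k) w))
        = - integral {0..1} (poly (pderiv p * (pderiv ^^ k) w))"
      using integral_poly_pderiv_by_parts[of "(pderiv ^^ k) w" p] by simp
    also have "integral {0..1} (poly (pderiv p * (pderiv ^^ k) w)) = 0"
    proof (cases "degree p = 0")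
      case True
      then have "pderiv p = 0" by (simp add: pderiv_eq_0_iff)
      moreover have "poly (0 :: real poly) = (\<lambda>x. 0)" by auto
      ultimately show ?thesis by simp
    next
      case False
      then show ?thesis using Suc by (simp add: degree_pderiv del: poly_mult)
    qed
    finally show ?case by simp
  qed simp
  from this[of p i] assms have "integral {0..1} (poly (p * (pderiv ^^ i) w)) = 0"
    by simp
  then have "integral {0..1} (\<lambda>x. (1 / fact i) * poly (p * (pderiv ^^ i) w) x) = 0"
    by (subst integral_mult_right) simp
  then show ?thesis
    by (simp add: legendre_def w_def mult.left_commute)
qed

lemma legendre_orthogonal:
  assumes "i \<noteq> j"
  shows "integral {0..1} (\<lambda>x. poly (legendre i) x * poly (legendre j) x) = 0"
  using assms integral_mult_legendre_eq_0[of "legendre i" j] integral_mult_legendre_eq_0[of "legendre j" i]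
  by (cases "i < j") (simp_all add: degree_legendre mult.commute)


section \<open>Degrees of freedom, basis functions and interpolants\<close>

text \<open>
  The indices are 1-based.  The degrees of freedom \<open>i + 3\<close> with \<open>0 \<le> i \<le> m - 3\<close> are those with
  index from 3 to \<open>m\<close>.  The values at indices outside \<open>1..m+1\<close> (for 0-forms)
  and \<open>1..m\<close> (for 1-forms) are never used.
\<close>

definition dof0 :: "nat \<Rightarrow> nat \<Rightarrow> (real \<Rightarrow> real) \<Rightarrow> real" where
  "dof0 m i u =
    (if i = 1 then d0 u 0
     else if i = 2 then d0 u 1
     else if i = m + 1 then u 0 + u 1
     else integral {0..1} (\<lambda>x. poly (legendre (i - 3)) x * d0 u x))"

definition dof1 :: "nat \<Rightarrow> (real \<Rightarrow> real) \<Rightarrow> real" where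
  "dof1 j v =
    (if j = 1 then v 0
     else if j = 2 then v 1
     else integral {0..1} (\<lambda>x. poly (legendre (j - 3)) x * v x))"

definition phi0 :: "nat \<Rightarrow> nat \<Rightarrow> real \<Rightarrow> real" where
  "phi0 m i x =
    (if i = 1 then x - 2 * x ^ 2 + x ^ 3
     else if i = 2 then - (x ^ 2) + x ^ 3
     else if i = 3 then - 1 / 2 + 3 * x ^ 2 - 2 * x ^ 3
     else if i = m + 1 then 1 / 2
     else legendre_K (i - 2) x)"

definition phi1 :: "nat \<Rightarrow> real \<Rightarrow> real" where
  "phi1 j x =
    (if j = 1 then 1 - 4 * x + 3 * x ^ 2
     else if j = 2 then - 2 * x + 3 * x ^ 2
     else if j = 3 then 6 * x - 6 * x ^ 2
     else legendre_L (j - 2) x)"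

definition interp0 :: "nat \<Rightarrow> (real \<Rightarrow> real) \<Rightarrow> real \<Rightarrow> real" where
  "interp0 m u = (\<lambda>x. \<Sum>i = 1..m + 1. dof0 m i u * phi0 m i x)"

definition interp1 :: "nat \<Rightarrow> (real \<Rightarrow> real) \<Rightarrow> real \<Rightarrow> real" where
  "interp1 m v = (\<lambda>x. \<Sum>j = 1..m. dof1 j v * phi1 j x)"

end

theory Submission
  imports Defs
begin

text \<open>Differentiation matches the two interpolants term by term. For \<open>i\<close> up to
  \<open>m\<close>, the functional \<open>dof0 m i\<close> at \<open>u\<close> is by definition
  \<open>dof1 i\<close> at \<open>d0 u\<close>, and \<open>phi1 i\<close> is the derivative of
  \<open>phi0 m i\<close>; the remaining basis function \<open>phi0 m (m + 1)\<close> is constant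
  and is killed. To differentiate formally, both interpolants are written as polynomials:
  \<open>phi0_poly\<close> supplies for each \<open>i\<close> one polynomial that represents
  \<open>phi0 m i\<close> and whose \<open>pderiv\<close> represents \<open>phi1 i\<close>, and
  \<open>d0_eqI\<close> turns \<open>pderiv\<close> back into \<open>d0\<close>. The degree bounds
  come from the same polynomials.\<close>

lemma poly_primitive_exists:
  fixes p :: "real poly"
  shows "\<exists>q. pderiv q = p \<and> poly q 0 = 0 \<and> degree q \<le> Suc (degree p)"
proof (intro exI conjI)
  let ?q = "\<Sum>k\<le>degree p. monom (coeff p k / of_nat (Suc k)) (Suc k)"
  have "pderiv ?q = (\<Sum>k\<le>degree p. monom (coeff p k) k)"
    by (simp add: higher_pderiv_sum[of 1, simplified] pderiv_monom del: of_nat_Suc)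
  then show "pderiv ?q = p"
    by (simp only: poly_as_sum_of_monoms)
  show "poly ?q 0 = 0"
    by (simp add: poly_sum poly_monom)
  show "degree ?q \<le> Suc (degree p)"
    by (intro degree_sum_le) (auto intro: order_trans[OF degree_monom_le])
qed

lemma integral_poly_pderiv:
  fixes q :: "real poly"
  assumes "a \<le> b"
  shows "integral {a..b} (poly (pderiv q)) = poly q b - poly q a"
  using assms
  by (intro integral_unique fundamental_theorem_of_calculus)
    (auto intro!: has_field_derivative_at_within[OF poly_DERIV]
      simp flip: has_real_derivative_iff_has_vector_derivative)

text \<open>Two integrations of a polynomial of degree \<open>i\<close> from 0 raise the degree by
  two. One witness serves both functions, which records that \<open>legendre_L\<close> is the
  derivative of \<open>legendre_K\<close>. For negative \<open>x\<close> the interval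
  \<open>{0..x}\<close> is empty, hence the restriction.\<close>

lemma legendre_K_poly:
  "\<exists>q. degree q \<le> i + 2 \<and>
    (\<forall>x\<ge>0. legendre_K i x = poly q x \<and> legendre_L i x = poly (pderiv q) x)"
proof -
  obtain r where r: "pderiv r = legendre i" "poly r 0 = 0" "degree r \<le> Suc i"
    using poly_primitive_exists[of "legendre i"] by (auto simp: degree_legendre)
  obtain q where q: "pderiv q = r" "poly q 0 = 0" "degree q \<le> Suc (degree r)"
    using poly_primitive_exists[of r] by auto
  have L: "legendre_L i x = poly r x" if "x \<ge> 0" for x
    using that integral_poly_pderiv[of 0 x r] r by (simp add: legendre_L_def)
  have "legendre_K i x = poly q x" if "x \<ge> 0" for x
  proof -
    have "legendre_K i x = integral {0..x} (poly r)"
      unfolding legendre_K_def using L by (intro integral_cong) auto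
    then show ?thesis
      using that integral_poly_pderiv[of 0 x q] q by simp
  qed
  with L r(3) q(1,3) show ?thesis
    by (intro exI[of _ q]) auto
qed

text \<open>The first three cases are explicit cubics, whose degree is allowed because
  \<open>m\<close> is at least 3; the others come from \<open>legendre_K_poly\<close> with degree
  \<open>i\<close>. Index \<open>m + 1\<close> is left out, having no partner among the
  1-forms.\<close>

lemma phi0_poly:
  assumes "m \<ge> 3" "i \<in> {1..m}"
  shows "\<exists>p. degree p \<le> m \<and>
    (\<forall>x\<in>{0..1}. phi0 m i x = poly p x \<and> phi1 i x = poly (pderiv p) x)"
proof -
  consider "i = 1" | "i = 2" | "i = 3" | "i \<ge> 4"
    using assms by force
  then show ?thesis
  proof cases
    case 1
    then show ?thesis using assms
      by (intro exI[of _ "[:0, 1, -2, 1:]"])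
        (auto simp: phi0_def phi1_def pderiv_pCons algebra_simps power2_eq_square power3_eq_cube)
  next
    case 2
    then show ?thesis using assms
      by (intro exI[of _ "[:0, 0, -1, 1:]"])
        (auto simp: phi0_def phi1_def pderiv_pCons algebra_simps power2_eq_square power3_eq_cube)
  next
    case 3
    then show ?thesis using assms
      by (intro exI[of _ "[:-1/2, 0, 3, -2:]"])
        (auto simp: phi0_def phi1_def pderiv_pCons algebra_simps power2_eq_square power3_eq_cube)
  next
    case 4
    obtain q where "degree q \<le> i - 2 + 2"
      "\<forall>x\<ge>0. legendre_K (i - 2) x = poly q x \<and> legendre_L (i - 2) x = poly (pderiv q) x"
      using legendre_K_poly by blast
    with 4 assms show ?thesis
      by (intro exI[of _ q]) (auto simp: phi0_def phi1_def)
  qed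
qed

text \<open>Agreement on the interval suffices, even at its end points, because \<open>d0\<close> is
  the derivative within the interval, which is unique there.\<close>

lemma d0_eqI:
  assumes "x \<in> {0..1}" "\<And>y. y \<in> {0..1} \<Longrightarrow> u y = poly p y"
  shows "d0 u x = poly (pderiv p) x"
proof -
  have "(poly p has_vector_derivative poly (pderiv p) x) (at x within {0..1})"
    using has_field_derivative_at_within[OF poly_DERIV]
    by (simp flip: has_real_derivative_iff_has_vector_derivative)
  then have "(u has_vector_derivative poly (pderiv p) x) (at x within {0..1})"
    by (rule has_vector_derivative_transform[OF assms(1,2), rotated])
  then show ?thesis
    unfolding d0_def using assms(1) by (intro vector_derivative_within_closed_interval) auto
qed

theorem lemma8p3:
  fixes m :: nat
  assumes "m \<ge> 3"
  shows "interp0 m \<in> C1_Lambda0 \<rightarrow> polys_upto m \<and>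
         interp1 m \<in> C0_Lambda1 \<rightarrow> polys_upto (m - 1) \<and>
         (\<forall>u\<in>C1_Lambda0. \<forall>x\<in>{0..1}. d0 (interp0 m u) x = interp1 m (d0 u) x)"
proof -
  obtain p where deg: "\<And>i. i \<in> {1..m} \<Longrightarrow> degree (p i) \<le> m"
    and p: "\<And>i x. i \<in> {1..m} \<Longrightarrow> x \<in> {0..1} \<Longrightarrow> phi0 m i x = poly (p i) x"
    and p': "\<And>i x. i \<in> {1..m} \<Longrightarrow> x \<in> {0..1} \<Longrightarrow> phi1 i x = poly (pderiv (p i)) x"
    using phi0_poly[OF assms] by metis
  define P where "P u = (\<Sum>i = 1..m. smult (dof0 m i u) (p i)) + [:dof0 m (m + 1) u / 2:]" for u
  define Q where "Q v = (\<Sum>j = 1..m. smult (dof1 j v) (pderiv (p j)))" for v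
  have P: "interp0 m u x = poly (P u) x" if "x \<in> {0..1}" for u x
  proof -
    \<comment> \<open>Since \<open>m + 1\<close> exceeds 3, none of the earlier branches of
      \<open>phi0\<close> applies.\<close>
    have "phi0 m (m + 1) x = 1 / 2"
      using assms by (simp add: phi0_def)
    moreover have "(\<Sum>i = 1..m. dof0 m i u * phi0 m i x) = (\<Sum>i = 1..m. dof0 m i u * poly (p i) x)"
      using p that by (intro sum.cong) auto
    ultimately show ?thesis
      by (simp add: interp0_def P_def poly_sum)
  qed
  have Q: "interp1 m v x = poly (Q v) x" if "x \<in> {0..1}" for v x
    unfolding interp1_def Q_def using p' that by (simp add: poly_sum)
  have degP: "degree (P u) \<le> m" for u
    unfolding P_def using deg
    by (intro degree_add_le degree_sum_le) (auto intro: order_trans[OF degree_smult_le])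
  have degQ: "degree (Q v) \<le> m - 1" for v
    unfolding Q_def using deg
    by (intro degree_sum_le) (auto intro!: diff_le_mono order_trans[OF degree_smult_le] simp: degree_pderiv)
  \<comment> \<open>The constant term vanishes, and for indices up to \<open>m\<close> the
    coefficients \<open>dof0 m i u\<close> and \<open>dof1 i (d0 u)\<close> unfold to the same
    expression.\<close>
  have "pderiv (P u) = Q (d0 u)" for u
    unfolding P_def Q_def
    by (auto simp: pderiv_add higher_pderiv_sum[of 1, simplified] pderiv_smult pderiv_pCons dof0_def dof1_def intro!: sum.cong)
  then have "d0 (interp0 m u) x = interp1 m (d0 u) x" if "x \<in> {0..1}" for u x
    using d0_eqI[OF that P] Q[OF that] by simp
  moreover have "interp0 m u \<in> polys_upto m" "interp1 m v \<in> polys_upto (m - 1)" for u v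
    unfolding polys_upto_def using P Q degP degQ by blast+
  ultimately show ?thesis
    by blast
qed

end
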